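(* Let $P$ and $\widetilde P$ be probability measures on a measurable space $(\Omega,\mathcal{F})$, let $\mathcal{G}\subset\mathcal{F}$ be a sub sigma-algebra, let $F:\Omega\to\overline{\mathbb{R}}$, $F\in L^1(\widetilde P)$, be $\mathcal{G}$-measurable, and suppose $G\in L^1(\widetilde{P})$ is a $\mathcal{G}$-measurable real-valued function that satisfies $R(\widetilde P|_{\mathcal{G}}\|P|_{\mathcal{G}})\leq E_{\widetilde{P}}[G]$. Then, for each of the two choices of sign, $$\pm E_{\widetilde P}[F]\leq \inf_{c>0}\left\{\frac{1}{c} \log E_P\left[\exp\left(\pm c F+G\right)\right]\right\}=\inf_{\eta>0}\left\{\eta \log E_P\left[\exp\left(\pm \eta^{-1} F+G\right)\right]\right\}.$$ The objective function $(0,\infty)\to (-\infty,\infty]$, $c\mapsto \frac{1}{c} \log E_P\left[\exp\left(\pm c F+G\right)\right]$ is quasiconvex and the objective function $(0,\infty)\to (-\infty,\infty]$, $\eta\mapsto \eta \log E_P\left[\exp\left(\pm \eta^{-1} F+G\right)\right]$ is convex.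
   Context: $\overline{\mathbb{R}}$ denotes the extended real line. $E_Q$ is expectation under the probability measure $Q$, and $Q|_{\mathcal{G}}$ is the restriction of $Q$ to the sub sigma-algebra $\mathcal{G}$. The relative entropy is $R(\widetilde P\|P)=E_{\widetilde P}[\log(d\widetilde P/dP)]$ if $\widetilde P\ll P$, and $+\infty$ otherwise. $\log$ is the natural logarithm; the continuous extensions of $\exp$ to $\overline{\mathbb{R}}$ and of $\log$ to $[0,\infty]$ are used. A formula with $\pm$ stands for two formulas, one with all upper signs and one with all lower signs. *)

theory Defs
  imports "HOL-Probability.Probability"
begin

definition exp_ereal :: "ereal \<Rightarrow> ennreal" where
  "exp_ereal x =
    (if x = -\<infinity> then 0 else if x = \<infinity> then \<infinity> else ennreal (exp (real_of_ereal x)))"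

definition ln_ennreal :: "ennreal \<Rightarrow> ereal" where
  "ln_ennreal x =
    (if x = 0 then -\<infinity> else if x = \<infinity> then \<infinity> else ereal (ln (enn2real x)))"

(* e2ennreal sends negative arguments to 0, so this is the integral of the positive part of f
   minus the integral of the negative part. As \<infinity> - \<infinity> = \<infinity> in ereal, the
   value is meaningful only if at least one of the two integrals is finite. *)
definition expectation_ereal :: "'a measure \<Rightarrow> ('a \<Rightarrow> ereal) \<Rightarrow> ereal" where
  "expectation_ereal M f =
    enn2ereal (\<integral>\<^sup>+x. e2ennreal (f x) \<partial>M) - enn2ereal (\<integral>\<^sup>+x. e2ennreal (- f x) \<partial>M)"

definition integrable_ereal :: "'a measure \<Rightarrow> ('a \<Rightarrow> ereal) \<Rightarrow> bool" where
  "integrable_ereal M f \<longleftrightarrow>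
    f \<in> borel_measurable M \<and> (\<integral>\<^sup>+x. e2ennreal \<bar>f x\<bar> \<partial>M) < \<infinity>"

(* relative_entropy Q P is R(Q || P). The library's KL_divergence is a real-valued Bochner
   integral, which is 0 when the log-density is not integrable; relative entropy must be
   \<infinity> there. The negative part of ln (dQ/dP) is always Q-integrable when Q is a probability
   measure absolutely continuous with respect to P, so the expectation is well defined. *)
definition relative_entropy :: "'a measure \<Rightarrow> 'a measure \<Rightarrow> ereal" where
  "relative_entropy Q P =
    (if absolutely_continuous P Q
     then expectation_ereal Q (\<lambda>x. ln_ennreal (RN_deriv P Q x))
     else \<infinity>)"

(* Intended for functions that do not take the value -\<infinity>, for which the right-hand side never
   contains \<infinity> - \<infinity>. For u = 0 or v = 0 recall that 0 * \<infinity> = 0 in ereal. *)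
definition ereal_convex_on :: "'a::real_vector set \<Rightarrow> ('a \<Rightarrow> ereal) \<Rightarrow> bool" where
  "ereal_convex_on S f \<longleftrightarrow> convex S \<and>
    (\<forall>x\<in>S. \<forall>y\<in>S. \<forall>u\<ge>0. \<forall>v\<ge>0. u + v = 1 \<longrightarrow>
      f (u *\<^sub>R x + v *\<^sub>R y) \<le> ereal u * f x + ereal v * f y)"

definition ereal_quasiconvex_on :: "'a::real_vector set \<Rightarrow> ('a \<Rightarrow> ereal) \<Rightarrow> bool" where
  "ereal_quasiconvex_on S f \<longleftrightarrow> convex S \<and>
    (\<forall>x\<in>S. \<forall>y\<in>S. \<forall>u\<ge>0. \<forall>v\<ge>0. u + v = 1 \<longrightarrow>
      f (u *\<^sub>R x + v *\<^sub>R y) \<le> max (f x) (f y))"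

(* The argument s, equal to 1 or -1, carries the choice of sign in front of F. *)
definition objective_c ::
  "'a measure \<Rightarrow> ('a \<Rightarrow> ereal) \<Rightarrow> ('a \<Rightarrow> real) \<Rightarrow> real \<Rightarrow> real \<Rightarrow> ereal" where
  "objective_c P F G s c =
    ereal (1 / c) *
      ln_ennreal (\<integral>\<^sup>+x. exp_ereal (ereal (s * c) * F x + ereal (G x)) \<partial>P)"

definition objective_eta ::
  "'a measure \<Rightarrow> ('a \<Rightarrow> ereal) \<Rightarrow> ('a \<Rightarrow> real) \<Rightarrow> real \<Rightarrow> real \<Rightarrow> ereal" where
  "objective_eta P F G s \<eta> =
    ereal \<eta> *
      ln_ennreal (\<integral>\<^sup>+x. exp_ereal (ereal (s * inverse \<eta>) * F x + ereal (G x)) \<partial>P)"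

end

theory Submission
  imports Defs
begin

text \<open>
  The bound is the Gibbs variational principle: \<open>E\<^sub>Q[X] - R(Q \<parallel> P) \<le> log E\<^sub>P[exp X]\<close>
  (lemma \<open>Donsker_Varadhan\<close>). Applied on the sub sigma-algebra with \<open>X = t F + G\<close>, the
  hypothesis on \<open>G\<close> says exactly that \<open>E\<^sub>Q[G]\<close> pays for the relative entropy, so what is
  left is \<open>t E\<^sub>Q[F] \<le> \<Lambda>(t)\<close> with \<open>\<Lambda>(t) = log E\<^sub>P[exp(t F + G)]\<close>
  (\<open>tilted_cgf_lower_bound\<close>). Taking \<open>t = \<plusminus>c\<close> and dividing by \<open>c\<close> gives the lower bound
  on the objective, and since \<open>E\<^sub>Q[F]\<close> is finite it also shows that the objective never takes
  the value \<open>-\<infinity>\<close>. Expectations over \<open>P\<close> and \<open>Q\<close> of measurable functions of the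
  sub sigma-algebra do not change under restriction, so this transfers back.

  Everything about the shape of the objectives comes from the convexity of \<open>\<Lambda>\<close> on each of
  the two half-lines, which is Hoelder's inequality (\<open>tilted_cgf_convex\<close>). The objective in
  \<open>\<eta>\<close> is the perspective \<open>\<eta> \<Lambda>(\<plusminus>1/\<eta>)\<close>, and the perspective of a convex function is convex.
  The objective in \<open>c\<close> is the same function at \<open>\<eta> = 1/c\<close>. Inversion is a bijection of
  \<open>(0, \<infinity>)\<close> that maps segments to segments, which gives the equality of the infima and
  turns convexity into quasiconvexity.
\<close>

section \<open>Extended exponential and logarithm\<close>

lemma measurable_exp_ereal [measurable]: "exp_ereal \<in> borel_measurable borel"
  unfolding exp_ereal_def[abs_def] by measurable

lemma measurable_ln_ennreal [measurable]: "ln_ennreal \<in> borel_measurable borel"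
  unfolding ln_ennreal_def[abs_def] by measurable

lemma real_of_ereal_ln_ennreal: "real_of_ereal (ln_ennreal x) = ln (enn2real x)"
  by (simp add: ln_ennreal_def)

lemma ln_ennreal_le:
  assumes "x \<le> ennreal (exp L)"
  shows "ln_ennreal x \<le> ereal L"
proof (cases x)
  case (real r)
  then show ?thesis
    using assms ln_mono[of r "exp L"] by (auto simp: ln_ennreal_def)
next
  case top
  then show ?thesis using assms by (simp add: top_unique)
qed

section \<open>Integrable extended-real functions\<close>

lemma e2ennreal_abs: "e2ennreal \<bar>x\<bar> = e2ennreal x + e2ennreal (- x)"
proof (cases x)
  case (real r)
  then show ?thesis by (cases "r \<ge> 0") (auto simp: ennreal_neg)
qed (auto simp: e2ennreal_neg)

lemma integrable_ereal_finite_AE: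
  assumes "integrable_ereal M f"
  shows "AE x in M. \<bar>f x\<bar> \<noteq> \<infinity>"
proof -
  have [measurable]: "f \<in> borel_measurable M" using assms by (simp add: integrable_ereal_def)
  have "AE x in M. e2ennreal \<bar>f x\<bar> \<noteq> \<infinity>"
    using assms by (intro nn_integral_PInf_AE) (auto simp: integrable_ereal_def)
  then show ?thesis by eventually_elim auto
qed

lemma integrable_ereal_real_of_ereal:
  assumes "integrable_ereal M f"
  shows "integrable M (\<lambda>x. real_of_ereal (f x))"
proof -
  have [measurable]: "f \<in> borel_measurable M" using assms by (simp add: integrable_ereal_def)
  have "(\<integral>\<^sup>+x. ennreal (norm (real_of_ereal (f x))) \<partial>M) = (\<integral>\<^sup>+x. e2ennreal \<bar>f x\<bar> \<partial>M)"
    using integrable_ereal_finite_AE[OF assms]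
    by (intro nn_integral_cong_AE, elim eventually_mono) (auto simp: ereal_infinity_cases)
  then show ?thesis
    using assms by (intro integrableI_bounded) (auto simp: integrable_ereal_def)
qed

lemma expectation_ereal_eq_integral:
  assumes "integrable_ereal M f"
  shows "expectation_ereal M f = ereal (\<integral>x. real_of_ereal (f x) \<partial>M)"
proof -
  let ?g = "\<lambda>x. real_of_ereal (f x)"
  have int: "integrable M ?g" by (rule integrable_ereal_real_of_ereal[OF assms])
  have pos: "(\<integral>\<^sup>+x. e2ennreal (f x) \<partial>M) = (\<integral>\<^sup>+x. ennreal (?g x) \<partial>M)"
    using integrable_ereal_finite_AE[OF assms]
    by (intro nn_integral_cong_AE, elim eventually_mono) auto
  have neg: "(\<integral>\<^sup>+x. e2ennreal (- f x) \<partial>M) = (\<integral>\<^sup>+x. ennreal (- ?g x) \<partial>M)"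
    using integrable_ereal_finite_AE[OF assms]
    by (intro nn_integral_cong_AE, elim eventually_mono) auto
  show ?thesis
    using int unfolding expectation_ereal_def pos neg real_lebesgue_integral_def[OF int]
      real_integrable_def
    by (cases rule: ennreal2_cases[of "(\<integral>\<^sup>+x. ennreal (?g x) \<partial>M)" "(\<integral>\<^sup>+x. ennreal (- ?g x) \<partial>M)"])
      (auto simp: enn2ereal_ennreal)
qed

section \<open>The Donsker-Varadhan inequality\<close>

text \<open>
  This is \<open>log (1/f) \<le> 1/f - 1\<close> multiplied by \<open>f\<close>. Integrated over \<open>P\<close>, with
  \<open>f = dQ/dP\<close>, it bounds the \<open>Q\<close>-integral of the negative part of the log-density.
\<close>

lemma neg_log_density_le_1:
  "f * e2ennreal (- ln_ennreal f) \<le> 1" if "f \<noteq> \<infinity>"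
proof (cases "f = 0")
  case True
  then show ?thesis by (simp add: ln_ennreal_def)
next
  case False
  with that obtain r where r: "f = ennreal r" "r > 0"
    by (cases f) (auto simp: zero_less_iff_neq_zero)
  have "- ln r = ln (1 / r)" using r by (simp add: ln_div)
  also have "\<dots> \<le> 1 / r - 1" using r by (intro ln_le_minus_one) auto
  finally have "r * (- ln r) \<le> r * (1 / r)" using r by (intro mult_left_mono) auto
  then have "r * (- ln r) \<le> 1" using r by simp
  moreover have "f * e2ennreal (- ln_ennreal f) = ennreal (r * (- ln r))"
    using r by (simp add: ln_ennreal_def ennreal_mult'[symmetric])
  ultimately show ?thesis
    using ennreal_leI[of "r * (- ln r)" 1] by simp
qed

text \<open>
  Any real upper bound on the relative entropy makes the log-density integrable: the negative part
  always has a finite integral, so an infinite positive part would make the entropy infinite.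
\<close>

lemma finite_relative_entropy:
  assumes P: "prob_space P" and Q: "prob_space Q" and sets: "sets Q = sets P"
    and R: "relative_entropy Q P \<le> ereal r"
  shows "absolutely_continuous P Q"
    and "integrable Q (\<lambda>x. ln (enn2real (RN_deriv P Q x)))"
    and "(\<integral>x. ln (enn2real (RN_deriv P Q x)) \<partial>Q) \<le> r"
proof -
  interpret P: prob_space P by fact
  interpret Q: prob_space Q by fact
  let ?f = "RN_deriv P Q"
  let ?l = "\<lambda>x. ln_ennreal (?f x)"
  show ac: "absolutely_continuous P Q"
    using R by (auto simp: relative_entropy_def split: if_splits)
  have dens: "density P ?f = Q" by (rule P.density_RN_deriv[OF ac sets])
  have fQ [measurable]: "?f \<in> borel_measurable Q"
    using borel_measurable_RN_deriv[of P Q] sets by (simp cong: measurable_cong_sets)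
  have "(\<integral>\<^sup>+x. e2ennreal (- ?l x) \<partial>Q) = (\<integral>\<^sup>+x. e2ennreal (- ?l x) \<partial>density P ?f)"
    by (simp add: dens)
  also have "\<dots> = (\<integral>\<^sup>+x. ?f x * e2ennreal (- ?l x) \<partial>P)"
    by (intro nn_integral_density) measurable
  also have "\<dots> \<le> (\<integral>\<^sup>+x. 1 \<partial>P)"
    using P.RN_deriv_finite[OF Q.sigma_finite_measure_axioms ac sets]
    by (intro nn_integral_mono_AE, elim eventually_mono) (rule neg_log_density_le_1)
  also have "\<dots> = 1" by (simp add: P.emeasure_space_1)
  finally have neg: "(\<integral>\<^sup>+x. e2ennreal (- ?l x) \<partial>Q) < \<infinity>"
    using ennreal_one_less_top le_less_trans by (metis infinity_ennreal_def)
  have E: "expectation_ereal Q ?l \<le> ereal r" using R ac by (simp add: relative_entropy_def)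
  then have pos: "(\<integral>\<^sup>+x. e2ennreal (?l x) \<partial>Q) < \<infinity>"
    unfolding expectation_ereal_def
    by (cases "(\<integral>\<^sup>+x. e2ennreal (?l x) \<partial>Q)") (auto simp: enn2ereal_top)
  have "(\<integral>\<^sup>+x. e2ennreal \<bar>?l x\<bar> \<partial>Q) =
      (\<integral>\<^sup>+x. e2ennreal (?l x) + e2ennreal (- ?l x) \<partial>Q)"
    by (intro nn_integral_cong e2ennreal_abs)
  also have "\<dots> = (\<integral>\<^sup>+x. e2ennreal (?l x) \<partial>Q) + (\<integral>\<^sup>+x. e2ennreal (- ?l x) \<partial>Q)"
    by (intro nn_integral_add) measurable
  finally have "integrable_ereal Q ?l"
    using pos neg by (simp add: integrable_ereal_def)
  note l = integrable_ereal_real_of_ereal[OF this] expectation_ereal_eq_integral[OF this]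
  show "integrable Q (\<lambda>x. ln (enn2real (?f x)))"
    using l(1) by (simp add: real_of_ereal_ln_ennreal)
  show "(\<integral>x. ln (enn2real (?f x)) \<partial>Q) \<le> r"
    using l(2) E by (simp add: real_of_ereal_ln_ennreal)
qed

text \<open>Jensen's inequality for the exponential, in the only form needed: integrate \<open>1 + y \<le> exp y\<close>.\<close>

lemma (in prob_space) integral_nonpos_of_nn_integral_exp_le_1:
  assumes Y: "integrable M Y" and le: "(\<integral>\<^sup>+x. ennreal (exp (Y x)) \<partial>M) \<le> 1"
  shows "(\<integral>x. Y x \<partial>M) \<le> 0"
proof -
  have [measurable]: "Y \<in> borel_measurable M" using Y by simp
  have int: "integrable M (\<lambda>x. exp (Y x))"
    using le by (intro integrableI_nonneg) (auto intro: le_less_trans)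
  have "1 + (\<integral>x. Y x \<partial>M) = (\<integral>x. 1 + Y x \<partial>M)"
    using Y by (simp add: prob_space)
  also have "\<dots> \<le> (\<integral>x. exp (Y x) \<partial>M)"
    using Y int by (intro integral_mono) auto
  also have "\<dots> \<le> 1"
    using le nn_integral_eq_integral[OF int] by (simp add: ennreal_le_1)
  finally show ?thesis by simp
qed

text \<open>
  Let \<open>f = dQ/dP\<close> and let \<open>Z\<close> be the partition function \<open>E\<^sub>P[exp X]\<close>. Changing measure
  gives \<open>E\<^sub>Q[exp(X - log f - log Z)] = E\<^sub>P[exp X; f > 0] / Z \<le> 1\<close>, so by Jensen's inequality
  \<open>E\<^sub>Q[X] - R(Q \<parallel> P) - log Z \<le> 0\<close>. The function \<open>X\<close> is finite only \<open>Q\<close>-almost surely;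
  where it is infinite the density vanishes \<open>P\<close>-almost surely, so these points do not
  contribute to the left-hand side.
\<close>

lemma Donsker_Varadhan:
  assumes P: "prob_space P" and Q: "prob_space Q" and sets: "sets Q = sets P"
    and R: "relative_entropy Q P \<le> ereal r"
    and X: "integrable_ereal Q X"
  shows "ereal ((\<integral>x. real_of_ereal (X x) \<partial>Q) - r) \<le> ln_ennreal (\<integral>\<^sup>+x. exp_ereal (X x) \<partial>P)"
proof -
  interpret P: prob_space P by fact
  interpret Q: prob_space Q by fact
  let ?f = "RN_deriv P Q"
  let ?l = "\<lambda>x. ln (enn2real (?f x))"
  let ?Xr = "\<lambda>x. real_of_ereal (X x)"
  define Z where "Z = (\<integral>\<^sup>+x. exp_ereal (X x) \<partial>P)"
  note ent = finite_relative_entropy[OF P Q sets R]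
  note ac = ent(1)
  have dens: "density P ?f = Q" by (rule P.density_RN_deriv[OF ac sets])
  have XQ: "X \<in> borel_measurable Q" using X by (simp add: integrable_ereal_def)
  then have XP [measurable]: "X \<in> borel_measurable P"
    using sets by (simp cong: measurable_cong_sets)
  have finQ: "AE x in Q. \<bar>X x\<bar> \<noteq> \<infinity>" by (rule integrable_ereal_finite_AE[OF X])
  consider "Z = 0" | "Z = \<infinity>" | z where "Z = ennreal z" "z > 0"
    by (cases Z) (auto simp: less_le)
  then have "ereal ((\<integral>x. ?Xr x \<partial>Q) - r) \<le> ln_ennreal Z"
  proof cases
    \<comment> \<open>Here \<open>X\<close> would be \<open>-\<infinity>\<close> almost surely under \<open>P\<close>, hence under \<open>Q\<close>, which integrability excludes.\<close>
    case 1
    then have "AE x in P. exp_ereal (X x) = 0"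
      unfolding Z_def by (subst (asm) nn_integral_0_iff_AE) auto
    then have "AE x in P. X x = -\<infinity>"
      by eventually_elim (auto simp: exp_ereal_def split: if_splits)
    then have "AE x in Q. X x = -\<infinity>"
      by (rule absolutely_continuous_AE[OF sets ac])
    with finQ have "AE x in Q. False" by eventually_elim auto
    then show ?thesis by simp
  next
    case 2
    then show ?thesis by (simp add: ln_ennreal_def)
  next
    case 3
    define Y where "Y x = ?Xr x - ?l x - ln z" for x
    have finP: "AE x in P. 0 < ?f x \<longrightarrow> \<bar>X x\<bar> \<noteq> \<infinity>"
      using finQ by (subst (asm) dens[symmetric], subst (asm) AE_density) auto
    have YP [measurable]: "Y \<in> borel_measurable P" unfolding Y_def[abs_def] by measurable
    have "(\<integral>\<^sup>+x. ennreal (exp (Y x)) \<partial>Q) = (\<integral>\<^sup>+x. ennreal (exp (Y x)) \<partial>density P ?f)"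
      by (simp add: dens)
    also have "\<dots> = (\<integral>\<^sup>+x. ?f x * ennreal (exp (Y x)) \<partial>P)"
      by (intro nn_integral_density) measurable
    also have "\<dots> \<le> (\<integral>\<^sup>+x. ennreal (1 / z) * exp_ereal (X x) \<partial>P)"
    proof (rule nn_integral_mono_AE)
      show "AE x in P. ?f x * ennreal (exp (Y x)) \<le> ennreal (1 / z) * exp_ereal (X x)"
        using finP P.RN_deriv_finite[OF Q.sigma_finite_measure_axioms ac sets]
      proof eventually_elim
        case (elim x)
        show ?case
        proof (cases "?f x = 0")
          case False
          with elim obtain y where y: "?f x = ennreal y" "y > 0"
            by (cases "?f x") (auto simp: less_le)
          obtain w where w: "X x = ereal w" using elim False by (cases "X x") (auto simp: zero_less_iff_neq_zero)
          have "y * exp (Y x) = 1 / z * exp w"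
            using y w 3 by (simp add: Y_def exp_diff)
          then show ?thesis using y w 3
            by (simp add: exp_ereal_def flip: ennreal_mult)
        qed simp
      qed
    qed
    also have "\<dots> = ennreal (1 / z) * Z"
      unfolding Z_def by (intro nn_integral_cmult) measurable
    also have "\<dots> = 1" using 3 by (simp flip: ennreal_mult)
    finally have "(\<integral>x. Y x \<partial>Q) \<le> 0"
      using integrable_ereal_real_of_ereal[OF X] ent(2)
      by (intro Q.integral_nonpos_of_nn_integral_exp_le_1) (auto simp: Y_def[abs_def])
    moreover have "(\<integral>x. Y x \<partial>Q) = (\<integral>x. ?Xr x \<partial>Q) - (\<integral>x. ?l x \<partial>Q) - ln z"
      using integrable_ereal_real_of_ereal[OF X] ent(2)
      by (simp add: Y_def[abs_def] Q.prob_space)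
    ultimately show ?thesis using ent(3) 3 by (simp add: ln_ennreal_def)
  qed
  then show ?thesis by (simp add: Z_def)
qed

section \<open>The tilted cumulant generating function\<close>

text \<open>
  The cumulant generating function of \<open>F\<close> with respect to the measure
  whose density over \<open>M\<close> is \<open>exp G\<close>.
  Both objectives are rescalings of it.
\<close>

definition tilted_cgf :: "'a measure \<Rightarrow> ('a \<Rightarrow> ereal) \<Rightarrow> ('a \<Rightarrow> real) \<Rightarrow> real \<Rightarrow> ereal" where
  "tilted_cgf M F G t = ln_ennreal (\<integral>\<^sup>+x. exp_ereal (ereal t * F x + ereal (G x)) \<partial>M)"

lemma objective_eta_eq_tilted_cgf:
  "objective_eta M F G s \<eta> = ereal \<eta> * tilted_cgf M F G (s * inverse \<eta>)"
  by (simp add: objective_eta_def tilted_cgf_def)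

lemma objective_c_eq_objective_eta: "objective_c M F G s c = objective_eta M F G s (inverse c)"
  by (simp add: objective_c_def objective_eta_def inverse_eq_divide)

lemma tilted_cgf_restr_to_subalg:
  assumes "subalgebra M \<G>" and [measurable]: "F \<in> borel_measurable \<G>" "G \<in> borel_measurable \<G>"
  shows "tilted_cgf (restr_to_subalg M \<G>) F G t = tilted_cgf M F G t"
  unfolding tilted_cgf_def by (subst nn_integral_subalgebra2[OF assms(1)]) auto

text \<open>
  The pointwise inequality behind Hoelder's: convexity of the exponential at the normalized
  exponents \<open>t\<^sub>i F + G - L\<^sub>i\<close>. The slopes \<open>t1\<close> and \<open>t2\<close> must have the same strict sign, because
  then \<open>t1 F\<close>, \<open>t2 F\<close> and their convex combination are the same infinity wherever \<open>F\<close> is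
  infinite; opposite infinities could not be added.
\<close>

lemma exp_convex_combination_le:
  fixes F :: ereal and g :: real
  assumes ab: "a > 0" "b > 0" "a + b = 1" and t: "t1 * t2 > 0"
  shows "exp_ereal (ereal (a * t1 + b * t2) * F + ereal g) \<le>
    ennreal (exp (a * L1 + b * L2)) *
      (ennreal (a * exp (- L1)) * exp_ereal (ereal t1 * F + ereal g) +
       ennreal (b * exp (- L2)) * exp_ereal (ereal t2 * F + ereal g))"
proof -
  have sgn: "t1 > 0 \<and> t2 > 0 \<and> a * t1 + b * t2 > 0 \<or> t1 < 0 \<and> t2 < 0 \<and> a * t1 + b * t2 < 0"
    using t ab by (auto simp: zero_less_mult_iff add_pos_pos add_neg_neg mult_pos_neg)
  show ?thesis
  proof (cases F)
    case (real w)
    define A where "A = t1 * w + g - L1"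
    define B where "B = t2 * w + g - L2"
    have "exp (a * A + b * B) \<le> a * exp A + b * exp B"
    proof -
      have "1 - b = a" using ab by simp
      then show ?thesis using convex_onD[OF exp_convex, of b A B, unfolded \<open>1 - b = a\<close>] ab by simp
    qed
    then have "exp (a * L1 + b * L2) * exp (a * A + b * B) \<le>
        exp (a * L1 + b * L2) * (a * exp A + b * exp B)"
      by (intro mult_left_mono) auto
    moreover have "exp (a * L1 + b * L2) * exp (a * A + b * B) = exp ((a * t1 + b * t2) * w + g)"
    proof -
      have "a * g + b * g = g" using ab(3) by (metis distrib_right mult_1)
      then have "(a * L1 + b * L2) + (a * A + b * B) = (a * t1 + b * t2) * w + g"
        unfolding A_def B_def by (simp add: algebra_simps)
      then show ?thesis by (metis exp_add)
    qed
    moreover have "exp A = exp (- L1) * exp (t1 * w + g)" "exp B = exp (- L2) * exp (t2 * w + g)"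
      by (simp_all add: A_def B_def exp_diff exp_minus field_simps)
    ultimately have "exp ((a * t1 + b * t2) * w + g) \<le> exp (a * L1 + b * L2) *
        ((a * exp (- L1)) * exp (t1 * w + g) + (b * exp (- L2)) * exp (t2 * w + g))"
      by (simp add: mult.assoc)
    then have "ennreal (exp ((a * t1 + b * t2) * w + g)) \<le> ennreal (exp (a * L1 + b * L2) *
        ((a * exp (- L1)) * exp (t1 * w + g) + (b * exp (- L2)) * exp (t2 * w + g)))"
      by (rule ennreal_leI)
    also have "\<dots> = ennreal (exp (a * L1 + b * L2)) *
        (ennreal (a * exp (- L1)) * ennreal (exp (t1 * w + g)) +
         ennreal (b * exp (- L2)) * ennreal (exp (t2 * w + g)))"
      using ab by (simp add: ennreal_mult ennreal_plus)
    finally show ?thesis by (simp add: real exp_ereal_def)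
  next
    case PInf
    then show ?thesis using sgn ab by (auto simp: exp_ereal_def ennreal_mult_top)
  next
    case MInf
    then show ?thesis using sgn ab by (auto simp: exp_ereal_def ennreal_mult_top)
  qed
qed

text \<open>
  With \<open>L\<^sub>i = \<Lambda>(t\<^sub>i)\<close> the two normalized exponentials have integral 1, so integrating the
  pointwise inequality gives \<open>exp \<Lambda>(a t\<^sub>1 + b t\<^sub>2) \<le> exp(a L\<^sub>1 + b L\<^sub>2)\<close>. The value \<open>-\<infinity>\<close> is
  excluded so that the right-hand side is never \<open>\<infinity> - \<infinity>\<close> and \<open>L\<^sub>i\<close> is a real number once it is
  not \<open>\<infinity>\<close>.
\<close>

lemma tilted_cgf_convex:
  assumes [measurable]: "F \<in> borel_measurable M" "G \<in> borel_measurable M"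
    and ab: "a > 0" "b > 0" "a + b = 1" and t: "t1 * t2 > 0"
    and ninf: "tilted_cgf M F G t1 \<noteq> -\<infinity>" "tilted_cgf M F G t2 \<noteq> -\<infinity>"
  shows "tilted_cgf M F G (a * t1 + b * t2) \<le>
    ereal a * tilted_cgf M F G t1 + ereal b * tilted_cgf M F G t2"
proof -
  define Z where "Z t = (\<integral>\<^sup>+x. exp_ereal (ereal t * F x + ereal (G x)) \<partial>M)" for t
  have cgf: "tilted_cgf M F G t = ln_ennreal (Z t)" for t by (simp add: tilted_cgf_def Z_def)
  show ?thesis
  proof (cases "Z t1 = \<infinity> \<or> Z t2 = \<infinity>")
    case True
    then show ?thesis using ab ninf
      by (cases "tilted_cgf M F G t1"; cases "tilted_cgf M F G t2")
        (auto simp: cgf ln_ennreal_def split: if_splits)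
  next
    case False
    then have "\<exists>L. Z t = ennreal (exp L) \<and> tilted_cgf M F G t = ereal L"
      if "t = t1 \<or> t = t2" for t
    proof -
      have "Z t \<noteq> 0" "Z t \<noteq> \<infinity>" using that ninf False by (auto simp: cgf ln_ennreal_def)
      then obtain z where "Z t = ennreal z" "z > 0" by (cases "Z t") (auto simp: less_le)
      then show ?thesis by (intro exI[of _ "ln z"]) (auto simp: cgf ln_ennreal_def)
    qed
    then obtain L1 L2 where L: "Z t1 = ennreal (exp L1)" "tilted_cgf M F G t1 = ereal L1"
      "Z t2 = ennreal (exp L2)" "tilted_cgf M F G t2 = ereal L2" by metis
    have "Z (a * t1 + b * t2) \<le> (\<integral>\<^sup>+x. ennreal (exp (a * L1 + b * L2)) *
      (ennreal (a * exp (- L1)) * exp_ereal (ereal t1 * F x + ereal (G x)) +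
       ennreal (b * exp (- L2)) * exp_ereal (ereal t2 * F x + ereal (G x))) \<partial>M)"
      unfolding Z_def by (intro nn_integral_mono exp_convex_combination_le ab t)
    also have "\<dots> = ennreal (exp (a * L1 + b * L2)) *
        (ennreal (a * exp (- L1)) * Z t1 + ennreal (b * exp (- L2)) * Z t2)"
      unfolding Z_def by (simp add: nn_integral_cmult nn_integral_add)
    also have "ennreal (a * exp (- L1)) * Z t1 + ennreal (b * exp (- L2)) * Z t2 = 1"
      using ab by (simp add: L mult.assoc flip: ennreal_mult ennreal_plus exp_add)
    finally show ?thesis
      by (simp add: cgf[of "a * t1 + b * t2"] L ln_ennreal_le)
  qed
qed

text \<open>
  The Donsker-Varadhan inequality for \<open>X = t F + G\<close> and \<open>r = E\<^sub>Q[G]\<close>, where the contribution of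
  \<open>G\<close> to \<open>E\<^sub>Q[X]\<close> cancels against the entropy bound.
\<close>

lemma tilted_cgf_lower_bound:
  assumes P: "prob_space P" and Q: "prob_space Q" and sets: "sets Q = sets P"
    and F: "integrable_ereal Q F" and G: "integrable Q G"
    and R: "relative_entropy Q P \<le> ereal (\<integral>x. G x \<partial>Q)"
  shows "ereal (t * (\<integral>x. real_of_ereal (F x) \<partial>Q)) \<le> tilted_cgf P F G t"
proof -
  let ?X = "\<lambda>x. ereal t * F x + ereal (G x)"
  have [measurable]: "F \<in> borel_measurable Q" "G \<in> borel_measurable Q"
    using F G by (auto simp: integrable_ereal_def)
  note Fr = integrable_ereal_real_of_ereal[OF F]
  have real_X: "AE x in Q. ?X x = ereal (t * real_of_ereal (F x) + G x)"
    using integrable_ereal_finite_AE[OF F] by eventually_elim auto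
  have "(\<integral>\<^sup>+x. e2ennreal \<bar>?X x\<bar> \<partial>Q) = (\<integral>\<^sup>+x. norm (t * real_of_ereal (F x) + G x) \<partial>Q)"
    using real_X by (intro nn_integral_cong_AE, elim eventually_mono) simp
  moreover have "integrable Q (\<lambda>x. t * real_of_ereal (F x) + G x)" using Fr G by simp
  ultimately have X: "integrable_ereal Q ?X"
    by (simp add: integrable_ereal_def integrable_iff_bounded)
  have "(\<integral>x. real_of_ereal (?X x) \<partial>Q) = (\<integral>x. t * real_of_ereal (F x) + G x \<partial>Q)"
    using real_X by (intro integral_cong_AE) (auto elim: eventually_mono)
  also have "\<dots> = t * (\<integral>x. real_of_ereal (F x) \<partial>Q) + (\<integral>x. G x \<partial>Q)"
    using Fr G by simp
  finally show ?thesis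
    using Donsker_Varadhan[OF P Q sets R X] by (simp add: tilted_cgf_def)
qed

section \<open>Convexity of the objective functions\<close>

text \<open>
  Perspective of a convex function: for \<open>e = u x + v y\<close> the point \<open>1/e\<close> is the convex combination
  of \<open>1/x\<close> and \<open>1/y\<close> with weights \<open>a = u x / e\<close> and \<open>b = v y / e\<close>. Multiplying the convexity
  inequality at these weights by \<open>e\<close> turns them into the coefficients \<open>u x\<close> and \<open>v y\<close>.
\<close>

lemma objective_eta_convex:
  assumes M: "F \<in> borel_measurable M" "G \<in> borel_measurable M"
    and s: "s \<noteq> 0" and ninf: "\<And>t. tilted_cgf M F G t \<noteq> -\<infinity>"
  shows "ereal_convex_on {0<..} (objective_eta M F G s)"
  unfolding ereal_convex_on_def
proof (intro conjI ballI allI impI)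
  show "convex {0::real<..}" by (rule convex_real_interval)
next
  fix x y u v :: real
  assume xy: "x \<in> {0<..}" "y \<in> {0<..}" and uv: "0 \<le> u" "0 \<le> v" "u + v = 1"
  let ?f = "objective_eta M F G s"
  show "?f (u *\<^sub>R x + v *\<^sub>R y) \<le> ereal u * ?f x + ereal v * ?f y"
  proof (cases "u = 0 \<or> v = 0")
    case True
    then show ?thesis using uv by (auto simp: zero_ereal_def[symmetric] one_ereal_def[symmetric])
  next
    case False
    define e where "e = u * x + v * y"
    have pos: "u > 0" "v > 0" "x > 0" "y > 0" using False uv xy by auto
    then have e: "e > 0" by (simp add: e_def add_pos_pos)
    define a where "a = u * x / e"
    define b where "b = v * y / e"
    have ab: "a > 0" "b > 0" using pos e by (auto simp: a_def b_def)
    have "a + b = 1" using e by (simp add: a_def b_def e_def flip: add_divide_distrib)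
    have ea: "e * a = u * x" "e * b = v * y" using e by (auto simp: a_def b_def)
    have "a * (s * inverse x) + b * (s * inverse y) = s * (u + v) / e"
      using pos by (simp add: a_def b_def field_simps add_divide_distrib)
    then have mix: "s * inverse e = a * (s * inverse x) + b * (s * inverse y)"
      by (simp add: uv divide_inverse)
    have "(s * inverse x) * (s * inverse y) = s\<^sup>2 * inverse (x * y)"
      by (simp add: power2_eq_square)
    then have "(s * inverse x) * (s * inverse y) > 0"
      using s pos by (metis mult_pos_pos positive_imp_inverse_positive zero_less_power2)
    then have "tilted_cgf M F G (s * inverse e) \<le>
        ereal a * tilted_cgf M F G (s * inverse x) + ereal b * tilted_cgf M F G (s * inverse y)"
      unfolding mix using ab \<open>a + b = 1\<close> ninf by (intro tilted_cgf_convex M) auto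
    then have "?f e \<le> ereal e *
        (ereal a * tilted_cgf M F G (s * inverse x) + ereal b * tilted_cgf M F G (s * inverse y))"
      unfolding objective_eta_eq_tilted_cgf using e by (intro ereal_mult_left_mono) auto
    also have "\<dots> = ereal (e * a) * tilted_cgf M F G (s * inverse x) +
        ereal (e * b) * tilted_cgf M F G (s * inverse y)"
      using e ab ninf[of "s * inverse x"] ninf[of "s * inverse y"]
      by (cases "tilted_cgf M F G (s * inverse x)"; cases "tilted_cgf M F G (s * inverse y)")
        (auto simp: algebra_simps)
    also have "\<dots> = ereal u * ?f x + ereal v * ?f y"
      unfolding objective_eta_eq_tilted_cgf ea by (simp flip: mult.assoc)
    finally show ?thesis by (simp add: e_def)
  qed
qed

lemma ereal_convex_combination_le_max:
  assumes "0 \<le> a" "0 \<le> b" "a + b = 1"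
  shows "ereal a * x + ereal b * y \<le> max x y"
proof -
  have "ereal a * x + ereal b * y \<le> ereal a * max x y + ereal b * max x y"
    using assms by (intro add_mono ereal_mult_left_mono) auto
  also have "\<dots> = (ereal a + ereal b) * max x y"
    using assms by (intro ereal_left_distrib[symmetric]) auto
  also have "\<dots> = max x y" using assms by (simp add: one_ereal_def[symmetric])
  finally show ?thesis .
qed

text \<open>
  A convex function is quasiconvex, and precomposing with inversion preserves this because
  inversion maps segments of \<open>(0, \<infinity>)\<close> onto segments; the weights
  \<open>a\<close> and \<open>b\<close> below locate the inverse of a convex combination between the inverses.
\<close>

lemma ereal_quasiconvex_on_inverse:
  fixes f :: "real \<Rightarrow> ereal"
  assumes "ereal_convex_on {0<..} f"
  shows "ereal_quasiconvex_on {0<..} (\<lambda>c. f (inverse c))"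
  unfolding ereal_quasiconvex_on_def
proof (intro conjI ballI allI impI)
  show "convex {0::real<..}" by (rule convex_real_interval)
next
  fix x y u v :: real
  assume xy: "x \<in> {0<..}" "y \<in> {0<..}" and uv: "0 \<le> u" "0 \<le> v" "u + v = 1"
  define c where "c = u * x + v * y"
  have c: "c > 0"
    using xy uv by (cases "u = 0") (auto simp: c_def intro!: add_pos_nonneg)
  define a where "a = u * x / c"
  define b where "b = v * y / c"
  have ab: "a \<ge> 0" "b \<ge> 0" using xy uv c by (auto simp: a_def b_def)
  have "a + b = 1" using c by (simp add: a_def b_def c_def flip: add_divide_distrib)
  have "a * inverse x + b * inverse y = (u + v) / c"
    using xy by (simp add: a_def b_def field_simps add_divide_distrib)
  then have mix: "inverse c = a *\<^sub>R inverse x + b *\<^sub>R inverse y"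
    by (simp add: uv divide_inverse)
  have "f (inverse c) \<le> ereal a * f (inverse x) + ereal b * f (inverse y)"
    unfolding mix using assms xy ab \<open>a + b = 1\<close> by (auto simp: ereal_convex_on_def)
  also have "\<dots> \<le> max (f (inverse x)) (f (inverse y))"
    using ab \<open>a + b = 1\<close> by (rule ereal_convex_combination_le_max)
  finally show "f (inverse (u *\<^sub>R x + v *\<^sub>R y)) \<le> max (f (inverse x)) (f (inverse y))"
    by (simp add: c_def)
qed

section \<open>The information inequality\<close>

lemma INF_objective_c_eq_objective_eta:
  "(INF c\<in>{0<..}. objective_c P F G s c) = (INF \<eta>\<in>{0<..}. objective_eta P F G s \<eta>)"
proof -
  have "inverse ` {0::real<..} = {0<..}"
    by (auto intro!: image_eqI[of _ inverse "inverse _"])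
  then have "(INF \<eta>\<in>{0<..}. objective_eta P F G s \<eta>) =
      (INF \<eta>\<in>inverse ` {0<..}. objective_eta P F G s \<eta>)" by simp
  then show ?thesis by (simp add: objective_c_eq_objective_eta image_image)
qed

theorem theorem2:
  fixes P Q \<G> :: "'a measure" and F :: "'a \<Rightarrow> ereal" and G :: "'a \<Rightarrow> real"
  assumes "prob_space P" and "prob_space Q" and "sets Q = sets P"
    and "subalgebra P \<G>"
    and "F \<in> borel_measurable \<G>" and "integrable_ereal Q F"
    and "G \<in> borel_measurable \<G>" and "integrable Q G"
    and "relative_entropy (restr_to_subalg Q \<G>) (restr_to_subalg P \<G>) \<le> ereal (\<integral>x. G x \<partial>Q)"
  shows "\<forall>s\<in>{1, -1}.
      ereal s * expectation_ereal Q F \<le> (INF c\<in>{0<..}. objective_c P F G s c) \<and>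
      (INF c\<in>{0<..}. objective_c P F G s c) = (INF \<eta>\<in>{0<..}. objective_eta P F G s \<eta>) \<and>
      objective_c P F G s ` {0<..} \<subseteq> {-\<infinity><..} \<and>
      ereal_quasiconvex_on {0<..} (objective_c P F G s) \<and>
      objective_eta P F G s ` {0<..} \<subseteq> {-\<infinity><..} \<and>
      ereal_convex_on {0<..} (objective_eta P F G s)"
proof
  fix s :: real
  assume s: "s \<in> {1, -1}"
  have subQ: "subalgebra Q \<G>"
    using assms(3,4) sets_eq_imp_space_eq[OF assms(3)] by (simp add: subalgebra_def)
  define P' where "P' = restr_to_subalg P \<G>"
  define Q' where "Q' = restr_to_subalg Q \<G>"
  have P': "prob_space P'" and Q': "prob_space Q'"
    using assms(1,2,4) subQ by (auto simp: P'_def Q'_def prob_space_restr_to_subalg)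
  have sets': "sets Q' = sets P'"
    by (simp add: P'_def Q'_def sets_restr_to_subalg[OF assms(4)] sets_restr_to_subalg[OF subQ])
  have F': "integrable_ereal Q' F"
    using assms(5,6) nn_integral_subalgebra2[OF subQ, of "\<lambda>x. e2ennreal \<bar>F x\<bar>"]
    by (simp add: integrable_ereal_def Q'_def measurable_in_subalg[OF subQ])
  have G': "integrable Q' G" and intG': "(\<integral>x. G x \<partial>Q') = (\<integral>x. G x \<partial>Q)"
    unfolding Q'_def using assms(7,8) subQ
    by (auto simp: integrable_in_subalg integral_subalgebra2)
  have "(\<lambda>x. real_of_ereal (F x)) \<in> borel_measurable \<G>" using assms(5) by measurable
  then have "(\<integral>x. real_of_ereal (F x) \<partial>Q') = (\<integral>x. real_of_ereal (F x) \<partial>Q)"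
    unfolding Q'_def using subQ by (intro integral_subalgebra2)
  then have EF: "expectation_ereal Q F = ereal (\<integral>x. real_of_ereal (F x) \<partial>Q')"
    by (simp add: expectation_ereal_eq_integral[OF assms(6)])
  define m where "m = (\<integral>x. real_of_ereal (F x) \<partial>Q')"
  \<comment> \<open>The inequality holds for the restricted measures and is then read over \<open>P\<close> itself.\<close>
  have lower: "ereal (t * m) \<le> tilted_cgf P F G t" for t
    using tilted_cgf_lower_bound[OF P' Q' sets' F' G', of t] assms(9)
    unfolding P'_def Q'_def[symmetric] m_def
    by (simp add: intG' tilted_cgf_restr_to_subalg[OF assms(4,5,7)])
  have lower_eta: "ereal (s * m) \<le> objective_eta P F G s \<eta>" if "\<eta> > 0" for \<eta>
  proof -
    have "ereal (s * m) = ereal \<eta> * ereal (s * inverse \<eta> * m)" using that by simp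
    also have "\<dots> \<le> objective_eta P F G s \<eta>"
      unfolding objective_eta_eq_tilted_cgf using that lower
      by (intro ereal_mult_left_mono) auto
    finally show ?thesis .
  qed
  then have lower_c: "ereal (s * m) \<le> objective_c P F G s c" if "c > 0" for c
    using that by (simp add: objective_c_eq_objective_eta)
  have "tilted_cgf P F G t \<noteq> -\<infinity>" for t using lower[of t] by auto
  then have convex: "ereal_convex_on {0<..} (objective_eta P F G s)"
    using s by (intro objective_eta_convex measurable_from_subalg[OF assms(4)] assms(5,7)) auto
  then have "ereal_quasiconvex_on {0<..} (objective_c P F G s)"
    using ereal_quasiconvex_on_inverse[OF convex]
    by (simp add: objective_c_eq_objective_eta[abs_def])
  moreover have "ereal s * expectation_ereal Q F \<le> (INF c\<in>{0<..}. objective_c P F G s c)"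
    using lower_c by (intro INF_greatest) (auto simp: EF m_def)
  moreover have "objective_eta P F G s ` {0<..} \<subseteq> {-\<infinity><..}" "objective_c P F G s ` {0<..} \<subseteq> {-\<infinity><..}"
    using lower_eta lower_c by (auto intro: less_le_trans[of _ "ereal (s * m)"])
  ultimately show "ereal s * expectation_ereal Q F \<le> (INF c\<in>{0<..}. objective_c P F G s c) \<and>
      (INF c\<in>{0<..}. objective_c P F G s c) = (INF \<eta>\<in>{0<..}. objective_eta P F G s \<eta>) \<and>
      objective_c P F G s ` {0<..} \<subseteq> {-\<infinity><..} \<and>
      ereal_quasiconvex_on {0<..} (objective_c P F G s) \<and>
      objective_eta P F G s ` {0<..} \<subseteq> {-\<infinity><..} \<and>
      ereal_convex_on {0<..} (objective_eta P F G s)"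
    using convex INF_objective_c_eq_objective_eta by blast
qed

end
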